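(* Let $\mathbf{A}$ be a Boolean algebra, regarded as a BL-algebra (with $a\ast b=a\wedge b$ and $a\to b=\neg a\vee b$), and let $\forall,\exists$ be unary operations on $A$. If $\langle\mathbf{A},\forall,\exists\rangle$ is an Epistemic BL-algebra, then $\langle\mathbf{A},\exists\rangle$ is a pseudomonadic algebra. Conversely, if $\langle\mathbf{A},\exists\rangle$ is a pseudomonadic algebra and $\forall a=\neg\exists\neg a$ for all $a\in A$, then $\langle\mathbf{A},\forall,\exists\rangle$ is an Epistemic BL-algebra.
   Context: A BL-algebra is an algebra $\langle A,\wedge,\vee,\ast,\to,0,1\rangle$ such that $\langle A,\wedge,\vee,0,1\rangle$ is a bounded lattice (with order $\le$), $\langle A,\ast,1\rangle$ is a commutative monoid, $a\ast b\le c$ iff $a\le b\to c$, and $a\wedge b=a\ast(a\to b)$ and $(a\to b)\vee(b\to a)=1$ hold; $\neg a:=a\to 0$. An Epistemic BL-algebra is a BL-algebra with unary operations $\forall,\exists$ satisfying, for all $a,b$: $\forall 1=1$; $\exists 0=0$; $\forall a\to\exists a=1$; $\forall(a\to\forall b)=\exists a\to\forall b$; $\forall(\forall a\to b)=\forall a\to\forall b$; $\exists a\to\forall\exists a=1$; $\forall(a\wedge b)=\forall a\wedge\forall b$; $\exists(a\vee b)=\exists a\vee\exists b$; $\exists(a\ast\exists b)=\exists a\ast\exists b$. A pseudomonadic algebra is a pair $\langle\mathbf{B},\exists\rangle$ with $\mathbf{B}$ a Boolean algebra and $\exists$ a unary operation such that for all $a,b$: (P1) $\exists 0=0$; (P2)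 $\exists(a\vee b)=\exists a\vee\exists b$; (P3) $\exists(\exists a\wedge b)=\exists a\wedge\exists b$; (P4) $\neg\exists a\le\exists\neg a$. *)

theory Defs
  imports Main
begin

unbundle lattice_syntax

locale bl_algebra =
  fixes mult :: "'a::bounded_lattice \<Rightarrow> 'a \<Rightarrow> 'a"  (infixl \<open>\<odot>\<close> 70)
    and imp :: "'a \<Rightarrow> 'a \<Rightarrow> 'a"  (infixr \<open>\<leadsto>\<close> 60)
  assumes comm_monoid: "comm_monoid (\<odot>) \<top>"
    and residuation: "a \<odot> b \<le> c \<longleftrightarrow> a \<le> b \<leadsto> c"
    and divisibility: "a \<sqinter> b = a \<odot> (a \<leadsto> b)"
    and prelinearity: "(a \<leadsto> b) \<squnion> (b \<leadsto> a) = \<top>"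

locale epistemic_bl_algebra = bl_algebra mult imp
  for mult :: "'a::bounded_lattice \<Rightarrow> 'a \<Rightarrow> 'a"  (infixl \<open>\<odot>\<close> 70)
    and imp :: "'a \<Rightarrow> 'a \<Rightarrow> 'a"  (infixr \<open>\<leadsto>\<close> 60) +
  fixes univ :: "'a \<Rightarrow> 'a"  (\<open>\<^bold>\<forall>_\<close> [90] 90)
    and exis :: "'a \<Rightarrow> 'a"  (\<open>\<^bold>\<exists>_\<close> [90] 90)
  assumes univ_top: "\<^bold>\<forall>\<top> = \<top>"
    and exis_bot: "\<^bold>\<exists>\<bottom> = \<bottom>"
    and univ_imp_exis: "\<^bold>\<forall>a \<leadsto> \<^bold>\<exists>a = \<top>"
    and univ_imp_univ: "\<^bold>\<forall>(a \<leadsto> \<^bold>\<forall>b) = \<^bold>\<exists>a \<leadsto> \<^bold>\<forall>b"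
    and univ_univ_imp: "\<^bold>\<forall>(\<^bold>\<forall>a \<leadsto> b) = \<^bold>\<forall>a \<leadsto> \<^bold>\<forall>b"
    and exis_imp_univ_exis: "\<^bold>\<exists>a \<leadsto> \<^bold>\<forall>\<^bold>\<exists>a = \<top>"
    and univ_inf: "\<^bold>\<forall>(a \<sqinter> b) = \<^bold>\<forall>a \<sqinter> \<^bold>\<forall>b"
    and exis_sup: "\<^bold>\<exists>(a \<squnion> b) = \<^bold>\<exists>a \<squnion> \<^bold>\<exists>b"
    and exis_mult_exis: "\<^bold>\<exists>(a \<odot> \<^bold>\<exists>b) = \<^bold>\<exists>a \<odot> \<^bold>\<exists>b"

locale pseudomonadic_algebra =
  fixes exis :: "'a::boolean_algebra \<Rightarrow> 'a"  (\<open>\<^bold>\<exists>_\<close> [90] 90)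
  assumes P1: "\<^bold>\<exists>\<bottom> = \<bottom>"
    and P2: "\<^bold>\<exists>(a \<squnion> b) = \<^bold>\<exists>a \<squnion> \<^bold>\<exists>b"
    and P3: "\<^bold>\<exists>(\<^bold>\<exists>a \<sqinter> b) = \<^bold>\<exists>a \<sqinter> \<^bold>\<exists>b"
    and P4: "- \<^bold>\<exists>a \<le> \<^bold>\<exists>(- a)"

definition bool_imp :: "'a::boolean_algebra \<Rightarrow> 'a \<Rightarrow> 'a"
  where "bool_imp a b = - a \<squnion> b"

lemma boolean_bl_algebra: "bl_algebra (inf :: 'a::boolean_algebra \<Rightarrow> 'a \<Rightarrow> 'a) bool_imp"
proof
  fix a b c :: 'a
  show "a \<sqinter> b \<le> c \<longleftrightarrow> a \<le> bool_imp b c"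
    by (simp add: bool_imp_def inf.commute shunt1)
  show "a \<sqinter> b = a \<sqinter> bool_imp a b"
    by (simp add: bool_imp_def inf_sup_distrib1)
  show "bool_imp a b \<squnion> bool_imp b a = \<top>"
    by (simp add: bool_imp_def ac_simps)
qed

end

theory Submission
  imports Defs
begin

text \<open>In a Boolean algebra the epistemic axioms force \<open>univ\<close> to be the De Morgan
  dual of \<open>exis\<close>: this is \<open>univ_imp_univ\<close> with \<bottom> as second
  argument, once \<open>univ \<bottom> = \<bottom>\<close> is known. P4 is then
  \<open>univ_imp_exis\<close> at a complement, and P1-P3 are axioms up to commutativity.
  Conversely, expanding \<open>univ\<close> as the dual turns the epistemic axioms into instances of
  P1-P4, except that two of them also need the range of \<open>exis\<close> to be closed under
  complement, which is \<open>exis_compl_exis\<close>.\<close>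

lemma bool_imp_eq_top_iff: "bool_imp a b = \<top> \<longleftrightarrow> a \<le> b"
  by (simp add: bool_imp_def sup_shunt)

lemma (in pseudomonadic_algebra) exis_top: "\<^bold>\<exists>\<top> = \<top>"
  using P4[of \<bottom>] by (simp add: P1 top.extremum_unique)

lemma (in pseudomonadic_algebra) exis_idem: "\<^bold>\<exists>(\<^bold>\<exists>a) = \<^bold>\<exists>a"
  using P3[of a \<top>] by (simp add: exis_top)

lemma (in pseudomonadic_algebra) exis_compl_exis: "\<^bold>\<exists>(- \<^bold>\<exists>a) = - \<^bold>\<exists>a"
proof (rule order.antisym)
  have "\<^bold>\<exists>a \<sqinter> \<^bold>\<exists>(- \<^bold>\<exists>a) = \<bottom>"
    using P3[of a "- \<^bold>\<exists>a"] by (simp add: P1)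
  then show "\<^bold>\<exists>(- \<^bold>\<exists>a) \<le> - \<^bold>\<exists>a"
    by (metis inf.commute inf_shunt)
  show "- \<^bold>\<exists>a \<le> \<^bold>\<exists>(- \<^bold>\<exists>a)"
    using P4[of "\<^bold>\<exists>a"] by (simp add: exis_idem)
qed

lemma epistemic_imp_pseudomonadic:
  fixes univ exis :: "'a::boolean_algebra \<Rightarrow> 'a"
  assumes "epistemic_bl_algebra inf bool_imp univ exis"
  shows "pseudomonadic_algebra exis"
proof -
  interpret epistemic_bl_algebra inf bool_imp univ exis by (fact assms)
  have univ_le_exis: "univ a \<le> exis a" for a
    using univ_imp_exis[of a] by (simp add: bool_imp_eq_top_iff)
  have "univ \<bottom> = \<bottom>"
    using univ_le_exis[of \<bottom>] by (simp add: exis_bot bot.extremum_unique)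
  \<comment> \<open>With \<open>b = \<bottom>\<close> both implications in the axiom become
    complements.\<close>
  then have univ_compl: "univ (- a) = - exis a" for a
    using univ_imp_univ[of a \<bottom>] by (simp add: bool_imp_def)
  show ?thesis
  proof
    fix a b
    show "exis (exis a \<sqinter> b) = exis a \<sqinter> exis b"
      using exis_mult_exis[of b a] by (simp add: inf.commute)
    show "- exis a \<le> exis (- a)"
      using univ_le_exis[of "- a"] by (simp add: univ_compl)
  qed (fact exis_bot exis_sup)+
qed

lemma pseudomonadic_imp_epistemic:
  fixes univ exis :: "'a::boolean_algebra \<Rightarrow> 'a"
  assumes "pseudomonadic_algebra exis" and univ: "\<And>a. univ a = - exis (- a)"
  shows "epistemic_bl_algebra inf bool_imp univ exis"
proof -
  interpret pseudomonadic_algebra exis by (fact assms(1))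
  interpret bl_algebra inf "bool_imp :: 'a \<Rightarrow> 'a \<Rightarrow> 'a" by (fact boolean_bl_algebra)
  show ?thesis
  proof
    fix a b
    show "univ \<top> = \<top>" "exis \<bottom> = \<bottom>"
      by (simp_all add: univ P1)
    show "bool_imp (univ a) (exis a) = \<top>"
      using P4[of "- a"] by (simp add: bool_imp_eq_top_iff univ)
    \<comment> \<open>After De Morgan this is the complement of P3 for \<open>a\<close> and
      \<open>exis (- b)\<close>.\<close>
    show "univ (bool_imp a (univ b)) = bool_imp (exis a) (univ b)"
      using P3[of "- b" a] by (simp add: bool_imp_def univ inf.commute)
    \<comment> \<open>The element \<open>univ a = - exis (- a)\<close> is a fixed point of
      \<open>exis\<close> by \<open>exis_compl_exis\<close>, so P3 may pull it out of the meet with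
      \<open>- b\<close>.\<close>
    show "univ (bool_imp (univ a) b) = bool_imp (univ a) (univ b)"
      using P3[of "- exis (- a)" "- b"] by (simp add: bool_imp_def univ exis_compl_exis)
    show "bool_imp (exis a) (univ (exis a)) = \<top>"
      by (simp add: bool_imp_eq_top_iff univ exis_compl_exis)
    show "univ (a \<sqinter> b) = univ a \<sqinter> univ b"
      by (simp add: univ P2)
    show "exis (a \<squnion> b) = exis a \<squnion> exis b"
      by (fact P2)
    show "exis (a \<sqinter> exis b) = exis a \<sqinter> exis b"
      using P3[of b a] by (simp add: inf.commute)
  qed
qed

theorem theorem3:
  fixes univ exis :: "'a::boolean_algebra \<Rightarrow> 'a"
  shows "(epistemic_bl_algebra inf bool_imp univ exis \<longrightarrow> pseudomonadic_algebra exis) \<and>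
    (pseudomonadic_algebra exis \<and> (\<forall>a. univ a = - exis (- a)) \<longrightarrow>
      epistemic_bl_algebra inf bool_imp univ exis)"
  using epistemic_imp_pseudomonadic pseudomonadic_imp_epistemic by blast

end
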